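(* Let $T\in(0,+\infty]$ and let $X$ be a solution on $[0,T)$ of the dyadic system $$\frac{d}{dt}X_n(t)=k_{n-1}X_{n-1}^2(t)-k_nX_n(t)X_{n+1}(t),\qquad X_n(0)=x_n,\qquad n\ge 1.$$ Then $X$ satisfies the weak energy inequality $$\|X(0)\|_H\ge\|X(t)\|_H\qquad\forall t\in[0,T)$$ if and only if it satisfies the strong energy inequality $$\|X(s)\|_H\ge\|X(t)\|_H\qquad\forall s,t\in[0,T)\text{ with }s<t.$$
   Context: Standing assumptions: $(k_n)_{n\ge0}$ is a fixed real sequence with $k_0=0$ and $0\le k_n\le C2^n$ for all $n\ge1$, for some constant $C$; by convention $X_0(t)=0$ for all $t\ge0$. $H=\ell^2$ is the space of real square-summable sequences indexed by $n\ge1$, with its usual norm $\|\cdot\|_H$. A solution on $[0,T)$ (global solution if $T=+\infty$) is a function $X=(X_n)_{n\ge1}$ defined on $[0,T)$ such that $X_n\in C^1([0,T))$ for all $n\ge1$, the system of equations holds for all $n\ge1$ with $X_n(0)=x_n$, and $X(t)\in H$ for all $t\in[0,T)$. *)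

theory Defs
  imports "HOL-Analysis.Analysis"
begin

text \<open>
  Sequences indexed by \<open>n \<ge> 1\<close> are functions on \<^typ>\<open>nat\<close> whose value at \<open>0\<close> plays no role
  in membership in \<open>H = \<ell>\<^sup>2\<close> or in the norm of \<open>H\<close>.
\<close>

definition in_H :: "(nat \<Rightarrow> real) \<Rightarrow> bool" where
  "in_H x \<longleftrightarrow> (\<lambda>n. (x n)\<^sup>2) summable_on {1..}"

definition norm_H :: "(nat \<Rightarrow> real) \<Rightarrow> real" where
  "norm_H x = sqrt (\<Sum>\<^sub>\<infinity>n\<in>{1..}. (x n)\<^sup>2)"

definition dyadic_coeffs :: "(nat \<Rightarrow> real) \<Rightarrow> bool" where
  "dyadic_coeffs k \<longleftrightarrow> k 0 = 0 \<and> (\<exists>C::real. \<forall>n\<ge>1. 0 \<le> k n \<and> k n \<le> C * 2 ^ n)"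

text \<open>The half-open interval \<open>[0,T)\<close>; the right end point may be \<open>\<infinity>\<close>.\<close>

definition time_interval :: "ereal \<Rightarrow> real set" where
  "time_interval T = {t. 0 \<le> t \<and> ereal t < T}"

text \<open>
  Derivatives are taken within the interval, hence one-sided at \<open>0\<close>; nothing is required of the
  function outside the interval.
\<close>

definition C1_on_interval :: "ereal \<Rightarrow> (real \<Rightarrow> real) \<Rightarrow> bool" where
  "C1_on_interval T f \<longleftrightarrow>
     (\<exists>f'. (\<forall>t\<in>time_interval T. (f has_real_derivative f' t) (at t within time_interval T)) \<and>
           continuous_on (time_interval T) f')"

text \<open>
  \<open>X n t\<close> is the \<open>n\<close>-th component at time \<open>t\<close>. The component of index \<open>0\<close> is the
  conventional \<open>X\<^sub>0 = 0\<close>.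
\<close>

definition dyadic_solution ::
  "(nat \<Rightarrow> real) \<Rightarrow> (nat \<Rightarrow> real) \<Rightarrow> ereal \<Rightarrow> (nat \<Rightarrow> real \<Rightarrow> real) \<Rightarrow> bool" where
  "dyadic_solution k x T X \<longleftrightarrow>
     (\<forall>t\<in>time_interval T. X 0 t = 0) \<and>
     (\<forall>n\<ge>1. C1_on_interval T (X n)) \<and>
     (\<forall>n\<ge>1. \<forall>t\<in>time_interval T.
        (X n has_real_derivative (k (n - 1) * (X (n - 1) t)\<^sup>2 - k n * X n t * X (n + 1) t))
          (at t within time_interval T)) \<and>
     (\<forall>n\<ge>1. X n 0 = x n) \<and>
     (\<forall>t\<in>time_interval T. in_H (\<lambda>n. X n t))"

definition weak_energy_inequality :: "ereal \<Rightarrow> (nat \<Rightarrow> real \<Rightarrow> real) \<Rightarrow> bool" where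
  "weak_energy_inequality T X \<longleftrightarrow>
     (\<forall>t\<in>time_interval T. norm_H (\<lambda>n. X n 0) \<ge> norm_H (\<lambda>n. X n t))"

definition strong_energy_inequality :: "ereal \<Rightarrow> (nat \<Rightarrow> real \<Rightarrow> real) \<Rightarrow> bool" where
  "strong_energy_inequality T X \<longleftrightarrow>
     (\<forall>s\<in>time_interval T. \<forall>t\<in>time_interval T. s < t \<longrightarrow>
        norm_H (\<lambda>n. X n s) \<ge> norm_H (\<lambda>n. X n t))"

end

theory Submission
  imports Defs
begin

text \<open>
  By variation of constants a component that is nonnegative at some time stays nonnegative, and
  the energy of the first \<open>N\<close> components has derivative
  \<open>- 2 k\<^sub>N X\<^sub>N\<^sup>2 X\<^sub>N\<^sub>+\<^sub>1\<close>. Fix \<open>s < t\<close>. If \<open>X\<^sub>N\<^sub>+\<^sub>1(s) \<ge> 0\<close> for infinitely many \<open>N\<close>, these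
  truncated energies decrease on \<open>[s,t]\<close>, and \<open>N \<rightarrow> \<infinity>\<close> gives the claim without using the weak
  inequality. Otherwise \<open>X\<^sub>N\<^sub>+\<^sub>1 < 0\<close> on all of \<open>[0,s]\<close> for all large \<open>N\<close>, so the truncated energies
  increase on \<open>[0,s]\<close>; hence the energy at \<open>s\<close> is at least the initial one, which dominates the
  energy at \<open>t\<close> by the weak inequality.
\<close>

text \<open>At interior points the derivative within \<open>{s..t}\<close> is a two-sided one, so
  the usual monotonicity criterion applies; the one-sided derivatives at the endpoints only supply
  continuity.\<close>

lemma nondecreasing_of_deriv_nonneg_within:
  fixes f :: "real \<Rightarrow> real"
  assumes "s \<le> t"
    and deriv: "\<And>u. u \<in> {s..t} \<Longrightarrow> (f has_real_derivative f' u) (at u within {s..t})"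
    and nonneg: "\<And>u. u \<in> {s..t} \<Longrightarrow> 0 \<le> f' u"
  shows "f s \<le> f t"
proof (rule DERIV_nonneg_imp_increasing_open[OF \<open>s \<le> t\<close>])
  fix u assume u: "s < u" "u < t"
  then have "(f has_real_derivative f' u) (at u)"
    using deriv[of u] by (simp add: at_within_Icc_at)
  with u nonneg[of u] show "\<exists>y. (f has_real_derivative y) (at u) \<and> 0 \<le> y"
    by auto
next
  show "continuous_on {s..t} f"
    using deriv by (rule DERIV_continuous_on)
qed

text \<open>Integrating factor: with \<open>A\<close> a primitive of \<open>a\<close>, the product
  \<open>f * exp A\<close> has derivative \<open>b * exp A\<close>, which is nonnegative, and
  \<open>exp A\<close> does not affect signs.\<close>

lemma nonneg_preserved:
  fixes f :: "real \<Rightarrow> real"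
  assumes "s \<le> t" and cont: "continuous_on {s..t} a"
    and deriv: "\<And>u. u \<in> {s..t} \<Longrightarrow> (f has_real_derivative b u - a u * f u) (at u within {s..t})"
    and nonneg: "\<And>u. u \<in> {s..t} \<Longrightarrow> 0 \<le> b u"
    and "0 \<le> f s"
  shows "0 \<le> f t"
proof -
  define A where "A u = integral {s..u} a" for u
  have A: "(A has_real_derivative a u) (at u within {s..t})" if "u \<in> {s..t}" for u
    unfolding A_def using integral_has_real_derivative[OF cont that] .
  have "f s * exp (A s) \<le> f t * exp (A t)"
  proof (rule nondecreasing_of_deriv_nonneg_within[OF \<open>s \<le> t\<close>])
    fix u assume u: "u \<in> {s..t}"
    show "((\<lambda>u. f u * exp (A u)) has_real_derivative b u * exp (A u)) (at u within {s..t})"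
      by (rule derivative_eq_intros deriv[OF u] A[OF u] refl)+ (simp add: algebra_simps)
    show "0 \<le> b u * exp (A u)"
      using nonneg[OF u] by simp
  qed
  moreover have "0 \<le> f s * exp (A s)"
    using \<open>0 \<le> f s\<close> by simp
  ultimately have "0 \<le> f t * exp (A t)"
    by linarith
  then show ?thesis
    by (simp add: zero_le_mult_iff)
qed

text \<open>Every finite set of indices lies below some \<open>N\<close> at which the comparison
  holds, so infinitely many such \<open>N\<close> suffice.\<close>

lemma norm_H_mono_of_frequently_le:
  assumes "in_H x" "in_H y"
    and freq: "\<exists>\<^sub>F N in sequentially. (\<Sum>n=1..N. (x n)\<^sup>2) \<le> (\<Sum>n=1..N. (y n)\<^sup>2)"
  shows "norm_H x \<le> norm_H y"
proof -
  have "(\<Sum>\<^sub>\<infinity>n\<in>{1..}. (x n)\<^sup>2) \<le> (\<Sum>\<^sub>\<infinity>n\<in>{1..}. (y n)\<^sup>2)"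
  proof (rule infsum_le_finite_sums)
    show "(\<lambda>n. (x n)\<^sup>2) summable_on {1..}"
      using \<open>in_H x\<close> by (simp add: in_H_def)
    fix F :: "nat set" assume F: "finite F" "F \<subseteq> {1..}"
    \<comment> \<open>Inserting \<open>0\<close> keeps \<open>Max\<close> meaningful when
      \<open>F\<close> is empty.\<close>
    obtain N where N: "N \<ge> Max (insert 0 F)" "(\<Sum>n=1..N. (x n)\<^sup>2) \<le> (\<Sum>n=1..N. (y n)\<^sup>2)"
      using freq unfolding frequently_sequentially by blast
    have "F \<subseteq> {1..N}"
      using F N(1) by auto
    then have "(\<Sum>n\<in>F. (x n)\<^sup>2) \<le> (\<Sum>n=1..N. (x n)\<^sup>2)"
      by (intro sum_mono2) auto
    also note N(2)
    also have "(\<Sum>n=1..N. (y n)\<^sup>2) \<le> (\<Sum>\<^sub>\<infinity>n\<in>{1..}. (y n)\<^sup>2)"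
      using \<open>in_H y\<close> by (intro finite_sum_le_infsum) (auto simp: in_H_def)
    finally show "(\<Sum>n\<in>F. (x n)\<^sup>2) \<le> (\<Sum>\<^sub>\<infinity>n\<in>{1..}. (y n)\<^sup>2)" .
  qed
  then show ?thesis
    by (simp add: norm_H_def)
qed

lemma Icc_subset_time_interval:
  assumes "s \<in> time_interval T" "t \<in> time_interval T"
  shows "{s..t} \<subseteq> time_interval T"
proof
  fix u assume u: "u \<in> {s..t}"
  then have "ereal u \<le> ereal t"
    by simp
  also have "\<dots> < T"
    using assms by (simp add: time_interval_def)
  finally show "u \<in> time_interval T"
    using u assms by (simp add: time_interval_def)
qed

context
  fixes k x :: "nat \<Rightarrow> real" and T :: ereal and X :: "nat \<Rightarrow> real \<Rightarrow> real"
  assumes coeffs: "dyadic_coeffs k" and sol: "dyadic_solution k x T X"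
begin

lemma coeff_nonneg: "0 \<le> k n"
  using coeffs unfolding dyadic_coeffs_def by (cases n) auto

lemma solution_has_derivative:
  assumes "n \<ge> 1" "u \<in> S" "S \<subseteq> time_interval T"
  shows "(X n has_real_derivative k (n - 1) * (X (n - 1) u)\<^sup>2 - k n * X n u * X (n + 1) u)
    (at u within S)"
proof (rule DERIV_subset)
  show "(X n has_real_derivative k (n - 1) * (X (n - 1) u)\<^sup>2 - k n * X n u * X (n + 1) u)
    (at u within time_interval T)"
    using sol assms unfolding dyadic_solution_def by blast
qed (fact assms)

text \<open>The equation is linear in \<open>X n\<close>, with coefficient
  \<open>k n * X (n + 1)\<close> and a nonnegative source from the preceding component.\<close>

lemma component_nonneg_preserved:
  assumes "s \<in> time_interval T" "t \<in> time_interval T" "s \<le> t" "n \<ge> 1" "0 \<le> X n s"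
  shows "0 \<le> X n t"
proof (rule nonneg_preserved[of s t _ "X n", OF \<open>s \<le> t\<close> _ _ _ \<open>0 \<le> X n s\<close>])
  note sub = Icc_subset_time_interval[OF assms(1,2)]
  have "continuous_on {s..t} (X (n + 1))"
    by (rule DERIV_continuous_on, rule solution_has_derivative) (use sub in auto)
  then show "continuous_on {s..t} (\<lambda>u. k n * X (n + 1) u)"
    by (intro continuous_intros)
  fix u assume u: "u \<in> {s..t}"
  show "(X n has_real_derivative k (n - 1) * (X (n - 1) u)\<^sup>2 - k n * X (n + 1) u * X n u)
      (at u within {s..t})"
    using solution_has_derivative[OF \<open>n \<ge> 1\<close> u sub] by (simp add: mult_ac)
  show "0 \<le> k (n - 1) * (X (n - 1) u)\<^sup>2"
    by (simp add: coeff_nonneg)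
qed

text \<open>The sum telescopes: what component \<open>n\<close> passes to component
  \<open>n + 1\<close> cancels, and only the flux out of component \<open>N\<close> remains. The
  induction starts from \<open>k 0 = 0\<close>.\<close>

lemma truncated_energy_has_derivative:
  assumes "u \<in> S" "S \<subseteq> time_interval T"
  shows "((\<lambda>u. \<Sum>n=1..N. (X n u)\<^sup>2) has_real_derivative - 2 * k N * (X N u)\<^sup>2 * X (N + 1) u)
    (at u within S)"
proof (induction N)
  case 0
  have "k 0 = 0"
    using coeffs by (simp add: dyadic_coeffs_def)
  then show ?case
    by simp
next
  case (Suc N)
  have *: "(X (Suc N) has_real_derivative
      k N * (X N u)\<^sup>2 - k (Suc N) * X (Suc N) u * X (Suc (Suc N)) u) (at u within S)"
    using solution_has_derivative[of "Suc N", OF _ assms] by simp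
  have "((\<lambda>u. (\<Sum>n=1..N. (X n u)\<^sup>2) + (X (Suc N) u)\<^sup>2) has_real_derivative
      - 2 * k (Suc N) * (X (Suc N) u)\<^sup>2 * X (Suc N + 1) u) (at u within S)"
    by (rule derivative_eq_intros Suc.IH * refl)+ (simp add: algebra_simps power2_eq_square)
  then show ?case
    by simp
qed

lemma truncated_energy_decreases:
  assumes "s \<in> time_interval T" "t \<in> time_interval T" "s \<le> t" "0 \<le> X (N + 1) s"
  shows "(\<Sum>n=1..N. (X n t)\<^sup>2) \<le> (\<Sum>n=1..N. (X n s)\<^sup>2)"
proof -
  note sub = Icc_subset_time_interval[OF assms(1,2)]
  have "- (\<Sum>n=1..N. (X n s)\<^sup>2) \<le> - (\<Sum>n=1..N. (X n t)\<^sup>2)"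
  proof (rule nondecreasing_of_deriv_nonneg_within[OF \<open>s \<le> t\<close>])
    fix u assume u: "u \<in> {s..t}"
    show "((\<lambda>u. - (\<Sum>n=1..N. (X n u)\<^sup>2)) has_real_derivative
        - (- 2 * k N * (X N u)\<^sup>2 * X (N + 1) u)) (at u within {s..t})"
      by (rule DERIV_minus[OF truncated_energy_has_derivative[OF u sub]])
    \<comment> \<open>The sign at \<open>s\<close> propagates forward, so the outgoing flux is
      nonnegative on all of \<open>{s..t}\<close>.\<close>
    have "0 \<le> X (N + 1) u"
      using component_nonneg_preserved[of s u "N + 1"] assms u sub by auto
    then show "0 \<le> - (- 2 * k N * (X N u)\<^sup>2 * X (N + 1) u)"
      using coeff_nonneg[of N] by simp
  qed
  then show ?thesis
    by simp
qed

lemma truncated_energy_increases: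
  assumes "s \<in> time_interval T" "t \<in> time_interval T" "s \<le> t" "X (N + 1) t < 0"
  shows "(\<Sum>n=1..N. (X n s)\<^sup>2) \<le> (\<Sum>n=1..N. (X n t)\<^sup>2)"
proof (rule nondecreasing_of_deriv_nonneg_within[OF \<open>s \<le> t\<close>])
  note sub = Icc_subset_time_interval[OF assms(1,2)]
  fix u assume u: "u \<in> {s..t}"
  show "((\<lambda>u. \<Sum>n=1..N. (X n u)\<^sup>2) has_real_derivative - 2 * k N * (X N u)\<^sup>2 * X (N + 1) u)
      (at u within {s..t})"
    by (rule truncated_energy_has_derivative[OF u sub])
  \<comment> \<open>Contrapositive of sign preservation: a nonnegative value at \<open>u\<close>
    would persist up to \<open>t\<close>.\<close>
  have "X (N + 1) u \<le> 0"
    using component_nonneg_preserved[of u t "N + 1"] assms u sub by force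
  then show "0 \<le> - 2 * k N * (X N u)\<^sup>2 * X (N + 1) u"
    using coeff_nonneg[of N] by (simp add: mult_nonneg_nonpos)
qed

lemma energy_le_of_weak_energy_inequality:
  assumes weak: "weak_energy_inequality T X"
    and st: "s \<in> time_interval T" "t \<in> time_interval T" "s \<le> t"
  shows "norm_H (\<lambda>n. X n t) \<le> norm_H (\<lambda>n. X n s)"
proof -
  have in_H: "in_H (\<lambda>n. X n u)" if "u \<in> time_interval T" for u
    using sol that unfolding dyadic_solution_def by blast
  have 0: "0 \<in> time_interval T" "0 \<le> s"
    using st by (auto simp: time_interval_def intro: le_less_trans[of _ "ereal s"])
  show ?thesis
  proof (cases "\<exists>\<^sub>F N in sequentially. 0 \<le> X (N + 1) s")
    case True
    then have "\<exists>\<^sub>F N in sequentially. (\<Sum>n=1..N. (X n t)\<^sup>2) \<le> (\<Sum>n=1..N. (X n s)\<^sup>2)"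
      by (rule frequently_elim1) (rule truncated_energy_decreases[OF st])
    then show ?thesis
      by (intro norm_H_mono_of_frequently_le in_H st)
  next
    case False
    then have "\<forall>\<^sub>F N in sequentially. X (N + 1) s < 0"
      by (simp add: not_frequently not_le)
    then have "\<forall>\<^sub>F N in sequentially. (\<Sum>n=1..N. (X n 0)\<^sup>2) \<le> (\<Sum>n=1..N. (X n s)\<^sup>2)"
      by (rule eventually_mono) (rule truncated_energy_increases[OF 0(1) st(1) 0(2)])
    then have "norm_H (\<lambda>n. X n 0) \<le> norm_H (\<lambda>n. X n s)"
      by (intro norm_H_mono_of_frequently_le in_H st 0 eventually_frequently) auto
    moreover have "norm_H (\<lambda>n. X n t) \<le> norm_H (\<lambda>n. X n 0)"
      using weak st(2) unfolding weak_energy_inequality_def by blast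
    ultimately show ?thesis
      by linarith
  qed
qed

end

theorem theorem1p3:
  fixes k x :: "nat \<Rightarrow> real" and T :: ereal and X :: "nat \<Rightarrow> real \<Rightarrow> real"
  assumes "dyadic_coeffs k"
    and "0 < T"
    and "dyadic_solution k x T X"
  shows "weak_energy_inequality T X \<longleftrightarrow> strong_energy_inequality T X"
proof
  assume "weak_energy_inequality T X"
  then show "strong_energy_inequality T X"
    unfolding strong_energy_inequality_def
    using energy_le_of_weak_energy_inequality[OF assms(1,3)] by auto
next
  assume strong: "strong_energy_inequality T X"
  show "weak_energy_inequality T X"
    unfolding weak_energy_inequality_def
  proof
    fix t assume t: "t \<in> time_interval T"
    have "0 \<in> time_interval T"
      using \<open>0 < T\<close> by (simp add: time_interval_def zero_ereal_def)
    \<comment> \<open>The strong inequality compares only distinct times; at \<open>t = 0\<close>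
      the claim is reflexivity.\<close>
    moreover have "t = 0 \<or> 0 < t"
      using t by (auto simp: time_interval_def)
    ultimately show "norm_H (\<lambda>n. X n t) \<le> norm_H (\<lambda>n. X n 0)"
      using strong t unfolding strong_energy_inequality_def by auto
  qed
qed

end
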